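(* Let $\Phi$ be a finite root system of rank $d$ with Weyl group $W$, and let $\mathrm{SF}_\Phi\subseteq\mathbb{R}^{\mathscr{R}}$ be the cone of $\Phi$-submodular functions $h:\mathscr{R}\to\mathbb{R}$. For every $w\in W$ and every $i\in[d]$, the inequality $$h(w\lambda_i)+h(ws_i\lambda_i)\ \ge\ \sum_{j\in N(i)} -A_{ji}\,h(w\lambda_j)$$ defines a facet of $\mathrm{SF}_\Phi$ (i.e., the corresponding hyperplane intersects $\mathrm{SF}_\Phi$ in a facet).
   Context: $V$ is a finite-dimensional real inner product space; $\Phi\subset V$ a finite root system (spans $V$, only multiples of $\alpha\in\Phi$ in $\Phi$ are $\pm\alpha$, closed under reflections $s_\alpha(x)=x-\frac{2\langle x,\alpha\rangle}{\langle\alpha,\alpha\rangle}\alpha$); $W$ the group generated by the $s_\alpha$. The Coxeter complex $\Sigma_\Phi$ is the fan whose chambers are the closures of the components of $V\setminus\bigcup_\alpha\alpha^\perp$. Fix a chamber $D$ with simple roots $\alpha_1,\dots,\alpha_d$ ($D=\{x:\langle\alpha_i,x\rangle\ge0\}$ irredundantly), $s_i=s_{\alpha_i}$, coroots $\alpha^\vee=2\alpha/\langle\alpha,\alpha\rangle$, Cartan matrix $A_{ij}=\langle\alpha_i^\vee,\alpha_j\rangle$, fundamental weights $\lambda_i$ with $\langle\lambda_i,\alpha_j^\vee\rangle=\delta_{ij}$, and $\mathscr{R}=W\{\lambda_1,\dots,\lambda_d\}$ (each ray of $\Sigma_\Phi$ contains exactly one element of $\mathscr{R}$). $N(i)$ is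 the set of $j\ne i$ with $A_{ij}\ne0$ (neighbors of $i$ in the Dynkin diagram). A function $h:\mathscr{R}\to\mathbb{R}$ is $\Phi$-submodular if its unique continuous extension to $V$ that is linear on each cone of $\Sigma_\Phi$ is convex; equivalently, it is the restriction of the support function $u\mapsto\max_{v\in P}\langle u,v\rangle$ of a polytope $P$ whose normal fan coarsens $\Sigma_\Phi$. *)

theory Defs
  imports "HOL-Analysis.Analysis" "HOL-Algebra.Bij" "HOL-Algebra.Generated_Groups"
begin

definition root_refl :: "'a::euclidean_space \<Rightarrow> 'a \<Rightarrow> 'a" where
  "root_refl \<alpha> x = x - (2 * (x \<bullet> \<alpha>) / (\<alpha> \<bullet> \<alpha>)) *\<^sub>R \<alpha>"

text \<open>No integrality is required. That roots are nonzero follows from the condition on multiples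
  (together with the spanning condition).\<close>

definition root_system :: "'a::euclidean_space set \<Rightarrow> bool" where
  "root_system \<Phi> \<longleftrightarrow>
     finite \<Phi> \<and>
     span \<Phi> = UNIV \<and>
     (\<forall>\<alpha>\<in>\<Phi>. \<Phi> \<inter> span {\<alpha>} = {\<alpha>, - \<alpha>}) \<and>
     (\<forall>\<alpha>\<in>\<Phi>. \<forall>\<beta>\<in>\<Phi>. root_refl \<alpha> \<beta> \<in> \<Phi>)"

definition weyl_group :: "'a::euclidean_space set \<Rightarrow> ('a \<Rightarrow> 'a) set" where
  "weyl_group \<Phi> = generate (BijGroup UNIV) (root_refl ` \<Phi>)"

definition chambers :: "'a::euclidean_space set \<Rightarrow> 'a set set" where
  "chambers \<Phi> = closure ` components (UNIV - (\<Union>\<alpha>\<in>\<Phi>. {x. \<alpha> \<bullet> x = 0}))"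

text \<open>A fan contains all faces of its maximal cones.\<close>

definition coxeter_complex :: "'a::euclidean_space set \<Rightarrow> 'a set set" where
  "coxeter_complex \<Phi> = {F. F \<noteq> {} \<and> (\<exists>C\<in>chambers \<Phi>. F face_of C)}"

definition simple_roots ::
  "'a::euclidean_space set \<Rightarrow> 'a set \<Rightarrow> nat \<Rightarrow> (nat \<Rightarrow> 'a) \<Rightarrow> bool" where
  "simple_roots \<Phi> D d \<alpha> \<longleftrightarrow>
     (\<forall>i\<in>{1..d}. \<alpha> i \<in> \<Phi>) \<and>
     D = {x. \<forall>i\<in>{1..d}. 0 \<le> \<alpha> i \<bullet> x} \<and>
     (\<forall>k\<in>{1..d}. D \<noteq> {x. \<forall>i\<in>{1..d} - {k}. 0 \<le> \<alpha> i \<bullet> x})"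

definition coroot :: "'a::euclidean_space \<Rightarrow> 'a" where
  "coroot \<alpha> = (2 / (\<alpha> \<bullet> \<alpha>)) *\<^sub>R \<alpha>"

definition cartan :: "(nat \<Rightarrow> 'a::euclidean_space) \<Rightarrow> nat \<Rightarrow> nat \<Rightarrow> real" where
  "cartan \<alpha> i j = coroot (\<alpha> i) \<bullet> \<alpha> j"

definition neighbors :: "nat \<Rightarrow> (nat \<Rightarrow> 'a::euclidean_space) \<Rightarrow> nat \<Rightarrow> nat set" where
  "neighbors d \<alpha> i = {j\<in>{1..d}. j \<noteq> i \<and> cartan \<alpha> i j \<noteq> 0}"

definition fundamental_weights ::
  "nat \<Rightarrow> (nat \<Rightarrow> 'a::euclidean_space) \<Rightarrow> (nat \<Rightarrow> 'a) \<Rightarrow> bool" where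
  "fundamental_weights d \<alpha> lam \<longleftrightarrow>
     (\<forall>i\<in>{1..d}. \<forall>j\<in>{1..d}. lam i \<bullet> coroot (\<alpha> j) = (if i = j then 1 else 0))"

definition weight_orbit ::
  "'a::euclidean_space set \<Rightarrow> nat \<Rightarrow> (nat \<Rightarrow> 'a) \<Rightarrow> 'a set" where
  "weight_orbit \<Phi> d lam = {w (lam i) | w i. w \<in> weyl_group \<Phi> \<and> i \<in> {1..d}}"

definition linear_on_cones :: "'a::euclidean_space set \<Rightarrow> ('a \<Rightarrow> real) \<Rightarrow> bool" where
  "linear_on_cones \<Phi> g \<longleftrightarrow>
     (\<forall>\<sigma>\<in>coxeter_complex \<Phi>. \<exists>f. linear f \<and> (\<forall>x\<in>\<sigma>. g x = f x))"

text \<open>Only the values of \<open>h\<close> on the set \<open>R\<close> of ray generators matter. The extension \<open>g\<close> is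
  uniquely determined by them, because every cone is generated by its rays.\<close>

definition submodular ::
  "'a::euclidean_space set \<Rightarrow> 'a set \<Rightarrow> ('a \<Rightarrow> real) \<Rightarrow> bool" where
  "submodular \<Phi> R h \<longleftrightarrow>
     (\<exists>g. continuous_on UNIV g \<and> linear_on_cones \<Phi> g \<and> (\<forall>r\<in>R. g r = h r) \<and>
          convex_on UNIV g)"

text \<open>The space of real functions on \<open>R\<close> is represented by \<open>real ^ 'r\<close>, where the bijection
  \<open>\<rho> :: 'r \<Rightarrow> 'a\<close> from the finite type \<open>'r\<close> onto \<open>R\<close> labels the coordinates; \<open>val \<rho> h v\<close> is the
  value of \<open>h\<close> at the element \<open>v\<close> of \<open>R\<close>.\<close>

definition val :: "('r::finite \<Rightarrow> 'a) \<Rightarrow> real ^ 'r \<Rightarrow> 'a \<Rightarrow> real" where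
  "val \<rho> h v = h $ inv_into UNIV \<rho> v"

definition SF ::
  "'a::euclidean_space set \<Rightarrow> 'a set \<Rightarrow> ('r::finite \<Rightarrow> 'a) \<Rightarrow> (real ^ 'r) set" where
  "SF \<Phi> R \<rho> = {h. submodular \<Phi> R (val \<rho> h)}"

end

theory Submission
  imports Defs
begin

text \<open>Crossing the wall of \<open>uD\<close> opposite to \<open>u \<lambda>\<^sub>k\<close>, the piecewise linear extension of \<open>h\<close> is convex iff
  \<open>h(u\<lambda>\<^sub>k) + h(us\<^sub>k\<lambda>\<^sub>k) + \<Sum>\<^sub>j A\<^sub>j\<^sub>k h(u\<lambda>\<^sub>j) \<ge> 0\<close>, because
  \<open>\<lambda>\<^sub>k + s\<^sub>k\<lambda>\<^sub>k = - \<Sum>\<^sub>j A\<^sub>j\<^sub>k \<lambda>\<^sub>j\<close>. If this holds at every wall, the extension is the maximum of its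
  linear pieces: from any chamber one reaches the chamber of \<open>x\<close> by crossing walls that separate it from
  \<open>x\<close>, and each crossing does not decrease the value of the piece at \<open>x\<close>. So the cone is cut out by the wall
  functionals, and it remains to find a point at which the functional of \<open>(w, i)\<close> vanishes and all
  other ones are positive. The support function of a permutahedron, the convex hull of the orbit of
  \<open>v = \<Sum>\<^sub>j \<lambda>\<^sub>j\<close>, gives the functional of \<open>(u, k)\<close> the value \<open>\<langle>\<alpha>\<^sub>k, v\<rangle>\<close>, which does not depend on \<open>u\<close>.
  Lowering it by \<open>\<langle>\<alpha>\<^sub>i, v\<rangle> / 2\<close> at \<open>w\<lambda>\<^sub>i\<close> and \<open>ws\<^sub>i\<lambda>\<^sub>i\<close> makes the functional of \<open>(w, i)\<close> zero. Any other
  functional loses at most half of its value, as a functional is determined by its pair of positive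
  terms.\<close>

section \<open>Reflections and the bijection group they generate\<close>

lemma root_refl_linear: "linear (root_refl \<beta>)"
  unfolding root_refl_def
  by (intro linearI) (simp_all add: inner_add_left algebra_simps add_divide_distrib)

lemma root_refl_inner: "root_refl \<beta> x \<bullet> y = x \<bullet> root_refl \<beta> y"
  by (simp add: root_refl_def inner_diff_left inner_diff_right inner_commute)

lemma root_refl_idem [simp]: "root_refl \<beta> (root_refl \<beta> x) = x"
  by (cases "\<beta> = 0") (simp_all add: root_refl_def inner_diff_left algebra_simps)

lemma root_refl_comp_self [simp]: "root_refl \<beta> \<circ> root_refl \<beta> = id"
  by (simp add: fun_eq_iff)

lemma root_refl_uminus: "root_refl (- \<beta>) = root_refl \<beta>"
  by (simp add: root_refl_def fun_eq_iff)

lemma root_refl_coroot: "root_refl \<beta> x = x - (x \<bullet> coroot \<beta>) *\<^sub>R \<beta>"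
  by (simp add: root_refl_def coroot_def)

lemma root_refl_coroot': "root_refl \<beta> x = x - (x \<bullet> \<beta>) *\<^sub>R coroot \<beta>"
  by (simp add: root_refl_def coroot_def mult.commute)

lemma orthogonal_root_refl: "orthogonal_transformation (root_refl \<beta>)"
  by (simp add: orthogonal_transformation_def root_refl_linear root_refl_inner)

text \<open>Orthogonal maps preserve the two inner products in a reflection. This is the conjugation
  rule for reflections, written without an inverse of \<open>f\<close>.\<close>

lemma root_refl_conj:
  assumes "orthogonal_transformation f"
  shows "root_refl (f \<beta>) (f x) = f (root_refl \<beta> x)"
  using assms
  by (simp add: root_refl_def orthogonal_transformation_def linear_diff linear_scale)

lemma bij_root_refl: "bij (root_refl \<beta>)"
  by (rule o_bij[of "root_refl \<beta>"]) simp_all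

lemma mult_BijGroup_UNIV: "bij f \<Longrightarrow> bij g \<Longrightarrow> f \<otimes>\<^bsub>BijGroup UNIV\<^esub> g = f \<circ> g"
  by (simp add: BijGroup_def Bij_def compose_def fun_eq_iff)

lemma one_BijGroup_UNIV: "\<one>\<^bsub>BijGroup UNIV\<^esub> = id"
  by (simp add: BijGroup_def fun_eq_iff)

text \<open>The inductive definition of \<open>generate\<close> adjoins inverses of generators; for
  reflections these are the generators themselves.\<close>

lemma inv_root_refl: "inv\<^bsub>BijGroup UNIV\<^esub> (root_refl \<beta>) = root_refl \<beta>"
proof (rule group.inv_equality[OF group_BijGroup])
  show "root_refl \<beta> \<otimes>\<^bsub>BijGroup UNIV\<^esub> root_refl \<beta> = \<one>\<^bsub>BijGroup UNIV\<^esub>"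
    by (simp add: mult_BijGroup_UNIV bij_root_refl one_BijGroup_UNIV)
qed (simp_all add: BijGroup_def Bij_def bij_root_refl)

section \<open>Signs of linear functionals, and facets of polyhedral cones\<close>

lemma inner_sign_on_connected:
  fixes \<beta> :: "'a::real_inner"
  assumes "connected K" and "\<And>x. x \<in> K \<Longrightarrow> \<beta> \<bullet> x \<noteq> 0"
  shows "(\<forall>x\<in>K. 0 < \<beta> \<bullet> x) \<or> (\<forall>x\<in>K. \<beta> \<bullet> x < 0)"
proof (rule ccontr)
  assume "\<not> ?thesis"
  then obtain x y where xy: "x \<in> K" "y \<in> K" "\<beta> \<bullet> x < 0" "0 < \<beta> \<bullet> y"
    using assms(2) by (meson linorder_neqE_linordered_idom)
  have "connected ((\<bullet>) \<beta> ` K)"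
    by (intro connected_continuous_image assms(1) continuous_intros)
  then have "0 \<in> (\<bullet>) \<beta> ` K"
    using connectedD_interval[of _ "\<beta> \<bullet> x" "\<beta> \<bullet> y" 0] xy by auto
  then show False
    using assms(2) by auto
qed

lemma inner_nonneg_closure:
  fixes \<beta> :: "'a::real_inner"
  assumes "\<And>x. x \<in> K \<Longrightarrow> 0 \<le> \<beta> \<bullet> x" "x \<in> closure K"
  shows "0 \<le> \<beta> \<bullet> x"
proof -
  have "closure K \<subseteq> {x. \<beta> \<bullet> x \<ge> 0}"
    using assms(1) by (intro closure_minimal closed_halfspace_ge) auto
  then show ?thesis
    using assms(2) by auto
qed

text \<open>The constraints other than \<open>a\<close> stay strict on an open neighbourhood
  \<open>T\<close> of \<open>p\<close>. Inside the hyperplane of \<open>a\<close>, \<open>T\<close>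
  shows that the face has codimension 1; on the positive side it shows that \<open>S\<close> is
  full-dimensional.\<close>

lemma facet_of_Int_halfspaces:
  fixes A :: "'a::euclidean_space set"
  assumes fin: "finite A" and a: "a \<in> A" "a \<noteq> 0"
    and p: "a \<bullet> p = 0" "\<And>b. b \<in> A \<Longrightarrow> b \<noteq> a \<Longrightarrow> 0 < b \<bullet> p"
  defines "S \<equiv> {x. \<forall>b\<in>A. 0 \<le> b \<bullet> x}"
  shows "(S \<inter> {x. a \<bullet> x = 0}) facet_of S"
proof -
  define T where "T = (\<Inter>b\<in>A - {a}. {x. 0 < b \<bullet> x})"
  have T: "open T" "p \<in> T"
    using fin p by (auto simp: T_def open_halfspace_gt intro!: open_INT)
  have S_eq: "S = (\<Inter>b\<in>A. {x. b \<bullet> x \<ge> 0})"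
    by (auto simp: S_def)
  have conv: "convex S"
    unfolding S_eq by (intro convex_INT convex_halfspace_ge)
  have face: "(S \<inter> {x. a \<bullet> x = 0}) face_of S"
    using conv a by (intro face_of_Int_supporting_hyperplane_ge) (auto simp: S_def)
  have "aff_dim ({x. a \<bullet> x = 0} \<inter> T) = aff_dim {x. a \<bullet> x = 0}"
    using T p by (intro aff_dim_convex_Int_open convex_hyperplane) auto
  moreover have sub: "{x. a \<bullet> x = 0} \<inter> T \<subseteq> S \<inter> {x. a \<bullet> x = 0}"
    unfolding T_def S_def by (clarsimp, metis DiffI empty_iff insert_iff less_imp_le order_refl)
  ultimately have F: "aff_dim (S \<inter> {x. a \<bullet> x = 0}) = DIM('a) - 1"
    using aff_dim_subset[of "{x. a \<bullet> x = 0} \<inter> T" "S \<inter> {x. a \<bullet> x = 0}"]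
      aff_dim_subset[of "S \<inter> {x. a \<bullet> x = 0}" "{x. a \<bullet> x = 0}"] a
    by (simp add: aff_dim_hyperplane)
  have U: "open ({x. 0 < a \<bullet> x} \<inter> T)"
    using T by (simp add: open_Int open_halfspace_gt)
  \<comment> \<open>Since \<open>p\<close> is a boundary point of the open halfspace, its
    neighbourhood \<open>T\<close> meets that halfspace.\<close>
  have "p \<in> closure {x. 0 < a \<bullet> x}"
    using a p by (simp add: closure_halfspace_gt)
  then have "{x. 0 < a \<bullet> x} \<inter> T \<noteq> {}"
    using T open_Int_closure_eq_empty[of T "{x. 0 < a \<bullet> x}"] by blast
  then have "aff_dim ({x. 0 < a \<bullet> x} \<inter> T) = DIM('a)"
    using U by (intro aff_dim_open)
  moreover have "{x. 0 < a \<bullet> x} \<inter> T \<subseteq> S"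
    unfolding T_def S_def by (clarsimp, metis DiffI empty_iff insert_iff less_imp_le)
  ultimately have "aff_dim S = DIM('a)"
    using aff_dim_subset[of "{x. 0 < a \<bullet> x} \<inter> T" S] aff_dim_le_DIM[of S] by auto
  moreover have "p \<in> S \<inter> {x. a \<bullet> x = 0}"
    using sub T p by auto
  ultimately show ?thesis
    using face F by (auto simp: facet_of_def)
qed

section \<open>Simple roots, coroots and fundamental weights as bases\<close>

locale based_root_system =
  fixes \<Phi> D :: "'a::euclidean_space set" and d :: nat and \<alpha> lam :: "nat \<Rightarrow> 'a"
  assumes root_system: "root_system \<Phi>"
    and rank: "d = dim \<Phi>"
    and chamber: "D \<in> chambers \<Phi>"
    and simple: "simple_roots \<Phi> D d \<alpha>"
    and weights: "fundamental_weights d \<alpha> lam"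
begin

text \<open>Keeps the lower bound of the index range \<open>{1..d}\<close> from being rewritten to
  \<open>Suc 0\<close>.\<close>

declare One_nat_def [simp del]

abbreviation W :: "('a \<Rightarrow> 'a) set" where "W \<equiv> weyl_group \<Phi>"

abbreviation s :: "nat \<Rightarrow> 'a \<Rightarrow> 'a" where "s k \<equiv> root_refl (\<alpha> k)"

lemma finite_roots: "finite \<Phi>"
  and span_roots: "span \<Phi> = UNIV"
  and root_multiples: "\<beta> \<in> \<Phi> \<Longrightarrow> \<Phi> \<inter> span {\<beta>} = {\<beta>, - \<beta>}"
  and root_refl_root: "\<beta> \<in> \<Phi> \<Longrightarrow> \<gamma> \<in> \<Phi> \<Longrightarrow> root_refl \<beta> \<gamma> \<in> \<Phi>"
  using root_system by (auto simp: root_system_def)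

lemma simple_root: "k \<in> {1..d} \<Longrightarrow> \<alpha> k \<in> \<Phi>"
  and D_eq: "D = {x. \<forall>k\<in>{1..d}. 0 \<le> \<alpha> k \<bullet> x}"
  using simple by (auto simp: simple_roots_def)

lemma uminus_root: "\<beta> \<in> \<Phi> \<Longrightarrow> - \<beta> \<in> \<Phi>"
  using root_multiples[of \<beta>] by auto

lemma lam_coroot: "j \<in> {1..d} \<Longrightarrow> k \<in> {1..d} \<Longrightarrow> lam j \<bullet> coroot (\<alpha> k) = (if j = k then 1 else 0)"
  using weights by (auto simp: fundamental_weights_def)

lemma simple_root_nonzero: "k \<in> {1..d} \<Longrightarrow> \<alpha> k \<noteq> 0"
  using lam_coroot[of k k] by (auto simp: coroot_def)

lemma lam_simple_root:
  assumes "j \<in> {1..d}" "k \<in> {1..d}"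
  shows "lam j \<bullet> \<alpha> k = (if j = k then (\<alpha> k \<bullet> \<alpha> k) / 2 else 0)"
  using lam_coroot[OF assms] simple_root_nonzero[OF assms(2)]
  by (auto simp: coroot_def split: if_splits)

lemma simple_root_lam:
  assumes "j \<in> {1..d}" "k \<in> {1..d}"
  shows "\<alpha> k \<bullet> lam j = (if j = k then (\<alpha> k \<bullet> \<alpha> k) / 2 else 0)"
  using lam_simple_root[OF assms] by (simp add: inner_commute)

lemma lam_in_D: "j \<in> {1..d} \<Longrightarrow> lam j \<in> D"
  by (simp add: D_eq simple_root_lam)

lemma sum_delta_inner:
  assumes "k \<in> {1..d}"
  shows "(\<Sum>j\<in>{1..d}. c j *\<^sub>R lam j) \<bullet> coroot (\<alpha> k) = c k"
proof -
  have "(\<Sum>j\<in>{1..d}. c j *\<^sub>R lam j) \<bullet> coroot (\<alpha> k) = (\<Sum>j\<in>{1..d}. if j = k then c j else 0)"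
    unfolding inner_sum_left by (rule sum.cong) (use assms in \<open>auto simp: lam_coroot\<close>)
  then show ?thesis
    using assms by simp
qed

text \<open>Pairing with \<open>lam k\<close> isolates the coefficient of \<open>\<alpha> k\<close>,
  so the simple roots are independent; their number \<open>d\<close> is the dimension of the
  space.\<close>

lemma span_simple_roots: "span (\<alpha> ` {1..d}) = UNIV"
proof -
  have inj: "inj_on \<alpha> {1..d}"
    by (rule inj_onI) (metis lam_coroot zero_neq_one)
  have "independent (\<alpha> ` {1..d})"
  proof (rule independent_if_scalars_zero)
    fix f x assume *: "(\<Sum>x\<in>\<alpha> ` {1..d}. f x *\<^sub>R x) = 0" and "x \<in> \<alpha> ` {1..d}"
    then obtain k where k: "k \<in> {1..d}" "x = \<alpha> k" by auto
    have "0 = lam k \<bullet> (\<Sum>j\<in>{1..d}. f (\<alpha> j) *\<^sub>R \<alpha> j)"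
      using * by (simp add: sum.reindex[OF inj] del: One_nat_def)
    also have "\<dots> = (\<Sum>j\<in>{1..d}. if j = k then f (\<alpha> j) * (\<alpha> j \<bullet> \<alpha> j / 2) else 0)"
      unfolding inner_sum_right by (rule sum.cong) (use k in \<open>auto simp: lam_simple_root\<close>)
    also have "\<dots> = f (\<alpha> k) * (\<alpha> k \<bullet> \<alpha> k / 2)"
      using k by simp
    finally show "f x = 0"
      using k simple_root_nonzero by simp
  qed simp
  moreover have "card (\<alpha> ` {1..d}) = DIM('a)"
    using rank span_roots dim_span[of \<Phi>] card_image[OF inj] by simp
  ultimately show ?thesis
    using card_ge_dim_independent[of "\<alpha> ` {1..d}" UNIV] by auto
qed

lemma expand_lam: "x = (\<Sum>j\<in>{1..d}. (x \<bullet> coroot (\<alpha> j)) *\<^sub>R lam j)"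
proof -
  let ?y = "x - (\<Sum>j\<in>{1..d}. (x \<bullet> coroot (\<alpha> j)) *\<^sub>R lam j)"
  have "orthogonal ?y b" if "b \<in> \<alpha> ` {1..d}" for b
  proof -
    from that obtain k where k: "k \<in> {1..d}" "b = \<alpha> k" by blast
    have "?y \<bullet> coroot (\<alpha> k) = 0"
      using k by (simp add: inner_diff_left sum_delta_inner)
    then show ?thesis
      using k simple_root_nonzero by (simp add: coroot_def orthogonal_def)
  qed
  then have "orthogonal ?y ?y"
    using orthogonal_to_span[of ?y "\<alpha> ` {1..d}" ?y] span_simple_roots by blast
  then show ?thesis
    by (simp add: orthogonal_def)
qed

text \<open>Dual to \<open>expand_lam\<close>: both sides have the same inner product with every
  \<open>y\<close>, as expanding \<open>y\<close> shows.\<close>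

lemma expand_coroot: "x = (\<Sum>j\<in>{1..d}. (x \<bullet> lam j) *\<^sub>R coroot (\<alpha> j))"
proof -
  have "y \<bullet> x = y \<bullet> (\<Sum>j\<in>{1..d}. (x \<bullet> lam j) *\<^sub>R coroot (\<alpha> j))" for y
    by (subst (1) expand_lam[of y]) (simp add: inner_sum_left inner_sum_right inner_commute mult.commute)
  then show ?thesis
    by (rule vector_eq_ldot[THEN iffD1, OF allI])
qed

lemma eq_if_lam_inner_eq: "(\<And>j. j \<in> {1..d} \<Longrightarrow> x \<bullet> lam j = y \<bullet> lam j) \<Longrightarrow> x = y"
  using expand_coroot[of x] expand_coroot[of y] by simp

subsection \<open>Positive roots\<close>

text \<open>By \<open>expand_coroot\<close>, this asks for nonnegative coefficients in the basis of
  simple coroots. It applies to all vectors, so that it can also express the dominance order, as in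
  \<open>pos (y - u y)\<close>.\<close>

definition pos :: "'a \<Rightarrow> bool" where
  "pos \<beta> \<longleftrightarrow> (\<forall>j\<in>{1..d}. 0 \<le> \<beta> \<bullet> lam j)"

text \<open>A root vanishes nowhere on the open component behind \<open>D\<close>, so it has
  constant sign there. The sign passes weakly to the closure, which contains the fundamental
  weights.\<close>

lemma pos_or_neg:
  assumes "\<beta> \<in> \<Phi>"
  shows "pos \<beta> \<or> pos (- \<beta>)"
proof -
  obtain K where K: "K \<in> components (UNIV - (\<Union>\<alpha>\<in>\<Phi>. {x. \<alpha> \<bullet> x = 0}))" "D = closure K"
    using chamber by (auto simp: chambers_def)
  have "\<beta> \<bullet> x \<noteq> 0" if "x \<in> K" for x
    using in_components_subset[OF K(1)] that assms by auto
  then have "(\<forall>x\<in>K. 0 < \<beta> \<bullet> x) \<or> (\<forall>x\<in>K. \<beta> \<bullet> x < 0)"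
    using inner_sign_on_connected in_components_connected[OF K(1)] by blast
  then have "(\<forall>x\<in>D. 0 \<le> \<beta> \<bullet> x) \<or> (\<forall>x\<in>D. 0 \<le> (- \<beta>) \<bullet> x)"
    unfolding K(2) using inner_nonneg_closure[of K \<beta>] inner_nonneg_closure[of K "- \<beta>"]
    by (auto simp: less_imp_le)
  then show ?thesis
    using lam_in_D by (auto simp: pos_def)
qed

text \<open>A zero root would lie on the line of every root \<open>\<gamma>\<close> and hence equal
  \<open>\<gamma>\<close> or its negative; then all roots would vanish and could not span.\<close>

lemma root_nonzero: "\<beta> \<in> \<Phi> \<Longrightarrow> \<beta> \<noteq> 0"
proof
  assume *: "\<beta> \<in> \<Phi>" "\<beta> = 0"
  then have "\<gamma> \<in> \<Phi> \<Longrightarrow> \<gamma> = 0" for \<gamma>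
    using root_multiples[of \<gamma>] span_zero[of "{\<gamma>}"] by auto
  then have "span \<Phi> \<subseteq> span {0}"
    by (intro span_mono) auto
  then have "(UNIV::'a set) \<subseteq> {0}"
    using span_roots by simp
  then show False
    using nonempty_Basis nonzero_Basis by blast
qed

lemma pos_simple: "k \<in> {1..d} \<Longrightarrow> pos (\<alpha> k)"
  by (simp add: pos_def simple_root_lam)

lemma not_pos_uminus: "pos \<beta> \<Longrightarrow> pos (- \<beta>) \<Longrightarrow> \<beta> = 0"
  by (rule eq_if_lam_inner_eq) (force simp: pos_def)

lemma s_lam:
  "j \<in> {1..d} \<Longrightarrow> k \<in> {1..d} \<Longrightarrow> s k (lam j) = (if j = k then lam k - \<alpha> k else lam j)"
  by (simp add: root_refl_coroot lam_coroot)

text \<open>The reflection \<open>s k\<close> fixes \<open>lam j\<close> for \<open>j\<close> other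
  than \<open>k\<close>, so it changes only the coefficient at \<open>k\<close>. If the result were
  negative, all other coefficients of \<open>\<beta>\<close> would vanish, making it a multiple of
  \<open>\<alpha> k\<close>.\<close>

lemma pos_s:
  assumes "\<beta> \<in> \<Phi>" "pos \<beta>" "k \<in> {1..d}" "\<beta> \<noteq> \<alpha> k"
  shows "pos (s k \<beta>)"
proof (rule ccontr)
  assume "\<not> pos (s k \<beta>)"
  then have neg: "pos (- s k \<beta>)"
    using pos_or_neg root_refl_root simple_root assms by blast
  have "\<beta> \<bullet> lam j = 0" if "j \<in> {1..d}" "j \<noteq> k" for j
  proof -
    have "s k \<beta> \<bullet> lam j = \<beta> \<bullet> lam j"
      using that assms by (simp add: root_refl_inner s_lam)
    then show ?thesis
      using neg assms that by (force simp: pos_def)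
  qed
  then have "(\<Sum>j\<in>{1..d}. (\<beta> \<bullet> lam j) *\<^sub>R coroot (\<alpha> j))
      = (\<Sum>j\<in>{1..d}. if j = k then (\<beta> \<bullet> lam j) *\<^sub>R coroot (\<alpha> j) else 0)"
    by (intro sum.cong) auto
  then have "\<beta> = (\<beta> \<bullet> lam k) *\<^sub>R coroot (\<alpha> k)"
    using expand_coroot[of \<beta>] assms by simp
  then have "\<beta> \<in> span {\<alpha> k}"
    by (metis coroot_def span_base span_scale singletonI)
  then have "\<beta> = - \<alpha> k"
    using root_multiples[of "\<alpha> k"] simple_root assms by auto
  then show False
    using not_pos_uminus[of "\<alpha> k"] pos_simple simple_root_nonzero assms by auto
qed

text \<open>\<open>s k\<close> keeps \<open>\<alpha> j\<close> positive, and the pairing of the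
  image with \<open>lam k\<close> is minus the inner product of the two roots.\<close>

lemma cartan_nonpos:
  assumes "j \<in> {1..d}" "k \<in> {1..d}" "j \<noteq> k"
  shows "cartan \<alpha> j k \<le> 0"
proof -
  have "\<alpha> j \<noteq> \<alpha> k"
    using assms lam_simple_root[of j j] lam_simple_root[of j k] simple_root_nonzero[of j] by auto
  then have "pos (s k (\<alpha> j))"
    using assms pos_s simple_root pos_simple by blast
  then have "0 \<le> s k (\<alpha> j) \<bullet> lam k"
    using assms by (simp add: pos_def)
  also have "\<dots> = - (\<alpha> j \<bullet> \<alpha> k)"
    using assms by (simp add: root_refl_inner s_lam inner_diff_right simple_root_lam)
  finally show ?thesis
    by (simp add: cartan_def coroot_def mult_nonneg_nonpos divide_nonneg_nonneg mult_le_0_iff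
        divide_le_0_iff)
qed

subsection \<open>Words in the simple reflections\<close>

text \<open>Lists supply a length for induction. Words need not be reduced.\<close>

definition word :: "nat list \<Rightarrow> 'a \<Rightarrow> 'a" where
  "word ks = foldr (\<lambda>k f. s k \<circ> f) ks id"

lemma word_simps [simp]: "word [] = id" "word (k # ks) = s k \<circ> word ks"
  by (simp_all add: word_def)

lemma word_append [simp]: "word (ks @ ls) = word ks \<circ> word ls"
  by (induction ks) auto

lemma word_orthogonal: "orthogonal_transformation (word ks)"
  by (induction ks)
    (simp_all add: orthogonal_transformation_id orthogonal_transformation_compose orthogonal_root_refl
      id_def del: comp_apply)

lemma word_root: "set ks \<subseteq> {1..d} \<Longrightarrow> \<beta> \<in> \<Phi> \<Longrightarrow> word ks \<beta> \<in> \<Phi>"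
  by (induction ks) (auto intro!: root_refl_root simple_root)

lemma word_rev: "word (rev ks) \<circ> word ks = id" "word ks \<circ> word (rev ks) = id"
  by (induction ks) (auto simp: fun_eq_iff)

text \<open>Applying the letters one by one, some letter \<open>a\<close> first makes the image of
  \<open>\<alpha> k\<close> negative. By \<open>pos_s\<close> the image just before is
  \<open>\<alpha> a\<close>, and composing with \<open>s k\<close> deletes this letter.\<close>

lemma exchange:
  assumes "set ks \<subseteq> {1..d}" "k \<in> {1..d}" "pos (- word ks (\<alpha> k))"
  shows "\<exists>ls. set ls \<subseteq> {1..d} \<and> length ls < length ks \<and> word ls = word ks \<circ> s k"
  using assms
proof (induction ks)
  case Nil
  then show ?case
    using not_pos_uminus[of "\<alpha> k"] pos_simple simple_root_nonzero by auto
next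
  case (Cons a ks)
  let ?\<beta> = "word ks (\<alpha> k)"
  have \<beta>: "?\<beta> \<in> \<Phi>"
    using Cons.prems by (intro word_root simple_root) auto
  show ?case
  proof (cases "pos (- ?\<beta>)")
    case True
    with Cons obtain ls where "set ls \<subseteq> {1..d}" "length ls < length ks" "word ls = word ks \<circ> s k"
      by (metis insert_subset list.simps(15))
    then show ?thesis
      using Cons.prems by (intro exI[of _ "a # ls"]) (auto simp: fun_eq_iff)
  next
    case False
    have "\<not> pos (s a ?\<beta>)"
      using Cons.prems not_pos_uminus[of "s a ?\<beta>"] root_nonzero root_refl_root \<beta> simple_root
      by (auto simp del: One_nat_def)
    then have eq: "?\<beta> = \<alpha> a"
      using False pos_or_neg[OF \<beta>] pos_s[OF \<beta>, of a] Cons.prems by auto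
    \<comment> \<open>Conjugation by \<open>word ks\<close>, which takes \<open>\<alpha> k\<close>
      to \<open>\<alpha> a\<close>, turns \<open>s a\<close> into \<open>s k\<close>, and the two
      copies of \<open>s k\<close> cancel.\<close>
    have "word (a # ks) \<circ> s k = word ks"
    proof
      fix x
      have "s a (word ks (s k x)) = word ks (s k (s k x))"
        using root_refl_conj[OF word_orthogonal[of ks], of "\<alpha> k" "s k x"] eq by simp
      then show "(word (a # ks) \<circ> s k) x = word ks x"
        by simp
    qed
    then show ?thesis
      using Cons.prems by (intro exI[of _ ks]) (simp_all add: fun_eq_iff)
  qed
qed

lemma D_coroot: "y \<in> D \<Longrightarrow> k \<in> {1..d} \<Longrightarrow> 0 \<le> y \<bullet> coroot (\<alpha> k)"
  by (simp add: D_eq coroot_def inner_commute)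

text \<open>The last letter \<open>k\<close> subtracts from \<open>y\<close> a nonnegative multiple
  of \<open>\<alpha> k\<close>. If the rest of the word keeps \<open>\<alpha> k\<close> positive,
  the image only gets lower; otherwise \<open>exchange\<close> yields a shorter word for the same
  map.\<close>

lemma word_dominance:
  assumes "set ks \<subseteq> {1..d}" "y \<in> D"
  shows "pos (y - word ks y)"
  using assms
proof (induction "length ks" arbitrary: ks rule: less_induct)
  case less
  show ?case
  proof (cases ks rule: rev_cases)
    case Nil
    then show ?thesis by (simp add: pos_def)
  next
    case (snoc ls k)
    have k: "k \<in> {1..d}" "set ls \<subseteq> {1..d}"
      using less.prems snoc by auto
    show ?thesis
    proof (cases "pos (word ls (\<alpha> k))")
      case True
      have "word ks y = word ls y - (y \<bullet> coroot (\<alpha> k)) *\<^sub>R word ls (\<alpha> k)"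
        using word_orthogonal[of ls] snoc
        by (simp add: root_refl_coroot orthogonal_transformation_def linear_diff linear_scale)
      moreover have "pos (y - word ls y)"
        using less k snoc by auto
      ultimately show ?thesis
        using True D_coroot[OF less.prems(2) k(1)]
        by (simp add: pos_def inner_diff_left) (smt (verit) mult_nonneg_nonneg)
    next
      case False
      then have "pos (- word ls (\<alpha> k))"
        using pos_or_neg word_root simple_root k by blast
      from exchange[OF k(2,1) this] obtain ls'
        where "set ls' \<subseteq> {1..d}" "length ls' < length ls" "word ls' = word ls \<circ> s k"
        by blast
      then show ?thesis
        using less.hyps[of ls'] less.prems snoc by simp
    qed
  qed
qed

text \<open>Induction on the height \<open>\<Sum>\<^sub>j \<langle>\<beta>, \<lambda>\<^sub>j\<rangle>\<close>, which a suitable simple reflection decreases.\<close>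

lemma root_refl_word:
  assumes "\<beta> \<in> \<Phi>" "pos \<beta>"
  shows "\<exists>ks. set ks \<subseteq> {1..d} \<and> word ks = root_refl \<beta>"
  using assms
proof (induction "card {\<gamma>\<in>\<Phi>. (\<Sum>j\<in>{1..d}. \<gamma> \<bullet> lam j) < (\<Sum>j\<in>{1..d}. \<beta> \<bullet> lam j)}"
    arbitrary: \<beta> rule: less_induct)
  case less
  let ?ht = "\<lambda>\<gamma>. \<Sum>j\<in>{1..d}. \<gamma> \<bullet> lam j"
  \<comment> \<open>Expanding the squared norm in coroots yields an index at which
    \<open>\<beta>\<close> has both a positive coefficient and a positive pairing, so that
    reflecting there lowers the height.\<close>
  have "0 < \<beta> \<bullet> \<beta>"
    using root_nonzero less.prems by simp
  also have "\<beta> \<bullet> \<beta> = (\<Sum>j\<in>{1..d}. (\<beta> \<bullet> lam j) * (\<beta> \<bullet> coroot (\<alpha> j)))"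
    by (subst (2) expand_coroot[of \<beta>]) (simp add: inner_sum_right)
  finally obtain k where k: "k \<in> {1..d}" "0 < (\<beta> \<bullet> lam k) * (\<beta> \<bullet> coroot (\<alpha> k))"
    by (meson not_less sum_nonpos)
  then have c: "0 < \<beta> \<bullet> coroot (\<alpha> k)"
    using less.prems by (force simp: pos_def zero_less_mult_iff)
  show ?case
  proof (cases "\<beta> = \<alpha> k")
    case True
    then show ?thesis
      using k by (intro exI[of _ "[k]"]) auto
  next
    case False
    let ?\<gamma> = "s k \<beta>"
    have \<gamma>: "?\<gamma> \<in> \<Phi>" "pos ?\<gamma>"
      using less.prems k False pos_s root_refl_root simple_root by blast+
    have "?ht (\<alpha> k) > 0"
      using k simple_root_nonzero
      by (intro sum_pos2[of _ k]) (auto simp: simple_root_lam)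
    moreover have "?ht ?\<gamma> = ?ht \<beta> - (\<beta> \<bullet> coroot (\<alpha> k)) * ?ht (\<alpha> k)"
      by (simp add: root_refl_coroot inner_diff_left sum_subtractf sum_distrib_left)
    ultimately have ht: "?ht ?\<gamma> < ?ht \<beta>"
      using c by simp
    \<comment> \<open>Heights are real numbers, so the induction counts the finitely many roots of
      smaller height instead.\<close>
    have "card {\<gamma>\<in>\<Phi>. ?ht \<gamma> < ?ht ?\<gamma>} < card {\<gamma>\<in>\<Phi>. ?ht \<gamma> < ?ht \<beta>}"
    proof (rule psubset_card_mono)
      show "finite {\<gamma>\<in>\<Phi>. ?ht \<gamma> < ?ht \<beta>}"
        using finite_roots by simp
      have "{\<gamma>\<in>\<Phi>. ?ht \<gamma> < ?ht ?\<gamma>} \<subseteq> {\<gamma>\<in>\<Phi>. ?ht \<gamma> < ?ht \<beta>}"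
        using ht by auto
      moreover have "?\<gamma> \<in> {\<gamma>\<in>\<Phi>. ?ht \<gamma> < ?ht \<beta>}" "?\<gamma> \<notin> {\<gamma>\<in>\<Phi>. ?ht \<gamma> < ?ht ?\<gamma>}"
        using ht \<gamma> by auto
      ultimately show "{\<gamma>\<in>\<Phi>. ?ht \<gamma> < ?ht ?\<gamma>} \<subset> {\<gamma>\<in>\<Phi>. ?ht \<gamma> < ?ht \<beta>}"
        by blast
    qed
    then obtain ks where ks: "set ks \<subseteq> {1..d}" "word ks = root_refl ?\<gamma>"
      using less.hyps \<gamma> by blast
    have "word ([k] @ ks @ [k]) = root_refl \<beta>"
    proof
      fix x
      show "word ([k] @ ks @ [k]) x = root_refl \<beta> x"
        using ks root_refl_conj[OF orthogonal_root_refl, of "\<alpha> k" \<beta> x] by simp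
    qed
    then show ?thesis
      using ks k by (intro exI[of _ "[k] @ ks @ [k]"]) auto
  qed
qed

section \<open>The Weyl group: words, finiteness, fundamental domain and stabilizers\<close>

lemma root_refl_is_word:
  assumes "\<beta> \<in> \<Phi>"
  obtains ks where "set ks \<subseteq> {1..d}" "root_refl \<beta> = word ks"
  using root_refl_word[of \<beta>] root_refl_word[of "- \<beta>"] pos_or_neg[OF assms] uminus_root[OF assms]
  by (metis assms root_refl_uminus)

lemma bij_word: "bij (word ks)"
  by (rule o_bij[OF word_rev])

text \<open>Simple reflections already generate, by \<open>root_refl_is_word\<close>. This transfers
  the inductions on words to the Weyl group.\<close>

lemma weyl_group_eq: "W = word ` {ks. set ks \<subseteq> {1..d}}"
proof (intro equalityI subsetI)
  fix w assume "w \<in> W"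
  then show "w \<in> word ` {ks. set ks \<subseteq> {1..d}}"
    unfolding weyl_group_def
  proof (induction rule: generate.induct)
    case one
    show ?case by (intro image_eqI[of _ _ "[]"]) (auto simp: one_BijGroup_UNIV)
  next
    case (incl h)
    then show ?case
      by (auto elim!: root_refl_is_word)
  next
    case (inv h)
    then obtain \<beta> ks where "set ks \<subseteq> {1..d}" "h = root_refl \<beta>" "root_refl \<beta> = word ks"
      by (metis imageE root_refl_is_word)
    then show ?case
      using inv_root_refl[of \<beta>] by auto
  next
    case (eng g h)
    then obtain ks ls where "set ks \<subseteq> {1..d}" "set ls \<subseteq> {1..d}" "g = word ks" "h = word ls"
      by auto
    then show ?case
      by (intro image_eqI[of _ _ "ks @ ls"]) (auto simp: mult_BijGroup_UNIV bij_word)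
  qed
next
  have "word ks \<in> W" if "set ks \<subseteq> {1..d}" for ks
    using that
  proof (induction ks)
    case Nil
    then show ?case
      using generate.one[of "BijGroup UNIV" "root_refl ` \<Phi>"]
      by (simp add: weyl_group_def one_BijGroup_UNIV id_def)
  next
    case (Cons k ks)
    have "s k \<in> W"
      unfolding weyl_group_def using simple_root Cons.prems by (intro generate.incl) auto
    then have "s k \<otimes>\<^bsub>BijGroup UNIV\<^esub> word ks \<in> W"
      using Cons unfolding weyl_group_def by (intro generate.eng) auto
    then show ?case
      by (simp only: mult_BijGroup_UNIV[OF bij_root_refl bij_word] word_simps)
  qed
  then show "w \<in> W" if "w \<in> word ` {ks. set ks \<subseteq> {1..d}}" for w
    using that by auto
qed

lemma W_id: "id \<in> W"
  unfolding weyl_group_eq by (intro image_eqI[of _ _ "[]"]) auto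

lemma W_comp:
  assumes "u \<in> W" "w \<in> W"
  shows "u \<circ> w \<in> W"
proof -
  obtain ks ls where "u = word ks" "set ks \<subseteq> {1..d}" "w = word ls" "set ls \<subseteq> {1..d}"
    using assms by (auto simp: weyl_group_eq)
  then show ?thesis
    unfolding weyl_group_eq by (intro image_eqI[of _ _ "ks @ ls"]) auto
qed

lemma W_s: "k \<in> {1..d} \<Longrightarrow> s k \<in> W"
  unfolding weyl_group_eq by (intro image_eqI[of _ _ "[k]"]) auto

lemma W_inverse:
  assumes "u \<in> W"
  obtains u' where "u' \<in> W" "\<And>x. u' (u x) = x" "\<And>x. u (u' x) = x"
proof -
  obtain ks where ks: "set ks \<subseteq> {1..d}" "u = word ks"
    using assms by (auto simp: weyl_group_eq)
  show thesis
    by (rule that[of "word (rev ks)"])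
      (use ks word_rev[of ks] in \<open>auto simp: weyl_group_eq fun_eq_iff intro!: imageI\<close>)
qed

lemma W_orthogonal: "u \<in> W \<Longrightarrow> orthogonal_transformation u"
  by (auto simp: weyl_group_eq word_orthogonal)

lemma W_linear: "u \<in> W \<Longrightarrow> linear u"
  by (simp add: W_orthogonal orthogonal_transformation_linear)

lemma W_inner: "u \<in> W \<Longrightarrow> u x \<bullet> u y = x \<bullet> y"
  using W_orthogonal by (auto simp: orthogonal_transformation_def)

lemma W_root: "u \<in> W \<Longrightarrow> \<beta> \<in> \<Phi> \<Longrightarrow> u \<beta> \<in> \<Phi>"
  by (auto simp: weyl_group_eq word_root)

lemma W_dominance: "u \<in> W \<Longrightarrow> y \<in> D \<Longrightarrow> pos (y - u y)"
  by (auto simp: weyl_group_eq word_dominance)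

text \<open>A linear map is determined on the spanning set \<open>\<Phi>\<close>, and elements of
  \<open>W\<close> map this finite set into itself.\<close>

lemma finite_W: "finite W"
proof (rule inj_on_finite)
  show "inj_on (\<lambda>u. restrict u \<Phi>) W"
  proof (rule inj_onI)
    fix u w assume "u \<in> W" "w \<in> W" and eq: "restrict u \<Phi> = restrict w \<Phi>"
    moreover have "u x = w x" if "x \<in> \<Phi>" for x
      using fun_cong[OF eq, of x] that by simp
    ultimately show "u = w"
      using linear_eq_on_span[of u w \<Phi>] W_linear span_roots by blast
  qed
  show "(\<lambda>u. restrict u \<Phi>) ` W \<subseteq> \<Phi> \<rightarrow>\<^sub>E \<Phi>"
    using W_root by auto
  show "finite (\<Phi> \<rightarrow>\<^sub>E \<Phi>)"
    using finite_roots by (simp add: finite_PiE)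
qed

text \<open>Dominance holds in both directions, for \<open>u\<close> at \<open>y\<close> and for its
  inverse at \<open>u y\<close>.\<close>

lemma W_fundamental_domain:
  assumes "u \<in> W" "y \<in> D" "u y \<in> D"
  shows "u y = y"
proof -
  obtain u' where u': "u' \<in> W" "u' (u y) = y"
    using W_inverse[OF assms(1)] by metis
  have "pos (y - u y)" "pos (u y - y)"
    using W_dominance[OF assms(1,2)] W_dominance[OF u'(1) assms(3)] u'(2) by auto
  then show ?thesis
    using not_pos_uminus[of "y - u y"] by simp
qed

text \<open>In the expansion of \<open>y - u y = 0\<close> by \<open>lam\<close>, every difference \<open>lam j - u (lam j)\<close> is a nonnegative
  combination of simple roots, so none with a positive coefficient can be nonzero.\<close>

lemma W_stabilizer:
  assumes "u \<in> W" "y \<in> D" "u y = y" "j \<in> {1..d}" "y \<bullet> coroot (\<alpha> j) \<noteq> 0"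
  shows "u (lam j) = lam j"
proof (rule eq_if_lam_inner_eq)
  fix m assume m: "m \<in> {1..d}"
  let ?t = "\<lambda>j. (y \<bullet> coroot (\<alpha> j)) * ((lam j - u (lam j)) \<bullet> lam m)"
  have "u y = (\<Sum>j\<in>{1..d}. (y \<bullet> coroot (\<alpha> j)) *\<^sub>R u (lam j))"
    by (subst (1) expand_lam) (simp add: linear_sum W_linear assms linear_scale)
  then have "(y - u y) \<bullet> lam m = (\<Sum>j\<in>{1..d}. ?t j)"
    by (subst (1) expand_lam[of y])
      (simp add: inner_diff_left inner_sum_left sum_subtractf algebra_simps)
  moreover have "0 \<le> ?t j" if "j \<in> {1..d}" for j
    using W_dominance[OF assms(1) lam_in_D[OF that]] D_coroot[OF assms(2) that] m
    by (simp add: pos_def)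
  ultimately have "?t j = 0"
    using sum_nonneg_eq_0_iff[of "{1..d}" ?t] assms by (auto simp: inner_commute)
  then show "u (lam j) \<bullet> lam m = lam j \<bullet> lam m"
    using assms by (simp add: inner_diff_left)
qed

subsection \<open>Piecewise linear functions\<close>

text \<open>The sum over all \<open>j\<close> other than \<open>k\<close> suits changes of basis;
  \<open>wall_neighbors\<close> converts it to the sum over neighbors, as the other coefficients
  vanish.\<close>

definition wall :: "('a \<Rightarrow> real) \<Rightarrow> ('a \<Rightarrow> 'a) \<Rightarrow> nat \<Rightarrow> real" where
  "wall h u k = h (u (lam k)) + h (u (s k (lam k))) + (\<Sum>j\<in>{1..d} - {k}. cartan \<alpha> j k * h (u (lam j)))"

lemma cartan_eq_0_commute: "cartan \<alpha> j k = 0 \<longleftrightarrow> cartan \<alpha> k j = 0"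
  by (auto simp: cartan_def coroot_def inner_commute)

lemma wall_neighbors:
  "wall h u k = h (u (lam k)) + h (u (s k (lam k)))
     - (\<Sum>j\<in>neighbors d \<alpha> k. - cartan \<alpha> j k * h (u (lam j)))"
proof -
  have "(\<Sum>j\<in>{1..d} - {k}. cartan \<alpha> j k * h (u (lam j)))
      = (\<Sum>j\<in>neighbors d \<alpha> k. cartan \<alpha> j k * h (u (lam j)))"
    by (intro sum.mono_neutral_right) (auto simp: neighbors_def cartan_eq_0_commute[of k])
  then show ?thesis
    by (simp add: wall_def sum_negf)
qed

lemma simple_root_expand_lam: "\<alpha> k = (\<Sum>j\<in>{1..d}. cartan \<alpha> j k *\<^sub>R lam j)"
  by (subst (1) expand_lam) (simp add: cartan_def inner_commute)

lemma cartan_diag: "k \<in> {1..d} \<Longrightarrow> cartan \<alpha> k k = 2"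
  using simple_root_nonzero by (simp add: cartan_def coroot_def)

text \<open>The left side is \<open>2 *\<^sub>R lam k - \<alpha> k\<close>; the diagonal Cartan
  entry 2 cancels the term of \<open>lam k\<close> in the expansion of
  \<open>\<alpha> k\<close>.\<close>

lemma wall_relation:
  assumes "k \<in> {1..d}"
  shows "lam k + s k (lam k) = (\<Sum>j\<in>{1..d} - {k}. (- cartan \<alpha> j k) *\<^sub>R lam j)"
proof -
  have "\<alpha> k = 2 *\<^sub>R lam k + (\<Sum>j\<in>{1..d} - {k}. cartan \<alpha> j k *\<^sub>R lam j)"
    using simple_root_expand_lam[of k] assms
    by (simp add: sum.remove[of _ k] cartan_diag)
  then have "2 *\<^sub>R lam k - \<alpha> k = - (\<Sum>j\<in>{1..d} - {k}. cartan \<alpha> j k *\<^sub>R lam j)"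
    by (simp add: algebra_simps)
  then show ?thesis
    using assms by (simp add: s_lam sum_negf scaleR_2 algebra_simps)
qed

text \<open>The coefficients in \<open>wall_relation\<close> are nonnegative by
  \<open>cartan_nonpos\<close>. So the midpoint of \<open>lam k\<close> and its mirror image lies in
  \<open>D\<close>, where an extension is linear.\<close>

lemma wall_relation_in_D:
  assumes "k \<in> {1..d}"
  shows "lam k + s k (lam k) \<in> D"
proof -
  have "0 \<le> \<alpha> m \<bullet> (\<Sum>j\<in>{1..d} - {k}. (- cartan \<alpha> j k) *\<^sub>R lam j)" if m: "m \<in> {1..d}" for m
    unfolding inner_sum_right inner_scaleR_right
    using assms m cartan_nonpos
    by (intro sum_nonneg mult_nonneg_nonneg) (auto simp: simple_root_lam)
  then show ?thesis
    by (simp only: D_eq wall_relation[OF assms]) auto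
qed

text \<open>The linear function that agrees with \<open>h\<close> on the rays of \<open>u ` D\<close>.\<close>

definition piece :: "('a \<Rightarrow> real) \<Rightarrow> ('a \<Rightarrow> 'a) \<Rightarrow> 'a \<Rightarrow> real" where
  "piece h u x = (\<Sum>j\<in>{1..d}. (x \<bullet> u (coroot (\<alpha> j))) * h (u (lam j)))"

lemma piece_linear: "linear (piece h u)"
  unfolding piece_def
  by (intro linearI) (simp_all add: inner_add_left algebra_simps sum.distrib sum_distrib_left)

lemma s_coroot: "s k (coroot (\<alpha> j)) = coroot (\<alpha> j) - cartan \<alpha> j k *\<^sub>R coroot (\<alpha> k)"
  by (simp add: root_refl_coroot' cartan_def)

text \<open>Passing to \<open>u \<circ> s k\<close> keeps the rays with \<open>j\<close> other than
  \<open>k\<close> and shifts their coordinates by multiples of coordinate \<open>k\<close>. Hence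
  the two pieces agree on the common wall, and their slopes differ by the wall functional.\<close>

lemma piece_adjacent:
  assumes "u \<in> W" "k \<in> {1..d}"
  shows "piece h u x - piece h (u \<circ> s k) x = wall h u k * (x \<bullet> u (coroot (\<alpha> k)))"
proof -
  have 1: "x \<bullet> u (s k (coroot (\<alpha> j))) = x \<bullet> u (coroot (\<alpha> j)) - cartan \<alpha> j k * (x \<bullet> u (coroot (\<alpha> k)))"
    for j
    by (simp add: s_coroot linear_diff linear_scale W_linear assms inner_diff_right)
  have 2: "(\<Sum>j\<in>{1..d} - {k}. (x \<bullet> u (s k (coroot (\<alpha> j)))) * h (u (s k (lam j))))
    = (\<Sum>j\<in>{1..d} - {k}. (x \<bullet> u (coroot (\<alpha> j))) * h (u (lam j))
        - (x \<bullet> u (coroot (\<alpha> k))) * (cartan \<alpha> j k * h (u (lam j))))"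
    by (rule sum.cong) (use assms in \<open>auto simp: s_lam 1 algebra_simps\<close>)
  have 3: "piece h v x = (x \<bullet> v (coroot (\<alpha> k))) * h (v (lam k))
      + (\<Sum>j\<in>{1..d} - {k}. (x \<bullet> v (coroot (\<alpha> j))) * h (v (lam j)))" for v
    using assms by (simp add: piece_def sum.remove[of _ k])
  show ?thesis
    using assms 1[of k]
    unfolding 3 wall_def comp_def 2 sum_subtractf sum_distrib_left[symmetric]
    by (simp add: cartan_diag algebra_simps)
qed

text \<open>The Weyl vector, an interior point of \<open>D\<close>, called \<open>v\<close> in the
  overview.\<close>

definition ctr :: 'a where
  "ctr = (\<Sum>j\<in>{1..d}. lam j)"

lemma ctr_coroot: "k \<in> {1..d} \<Longrightarrow> ctr \<bullet> coroot (\<alpha> k) = 1"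
  using sum_delta_inner[of k "\<lambda>_. 1"] by (simp add: ctr_def)

lemma simple_root_ctr: "k \<in> {1..d} \<Longrightarrow> 0 < \<alpha> k \<bullet> ctr"
  using ctr_coroot[of k] simple_root_nonzero[of k] inner_gt_zero_iff[of "\<alpha> k"]
  by (simp add: coroot_def inner_commute[of ctr] field_simps)

text \<open>The chamber \<open>v\<close> is found by maximizing \<open>v ctr \<bullet> x\<close>: crossing a wall that separates \<open>v ` D\<close> from \<open>x\<close>
  would increase it.\<close>

lemma climb:
  assumes "\<And>u k. u \<in> W \<Longrightarrow> k \<in> {1..d} \<Longrightarrow> 0 \<le> wall h u k" and u: "u \<in> W"
  obtains v where "v \<in> W" "\<And>k. k \<in> {1..d} \<Longrightarrow> 0 \<le> v (\<alpha> k) \<bullet> x" "piece h u x \<le> piece h v x"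
proof -
  let ?V = "{v\<in>W. piece h u x \<le> piece h v x}"
  have V: "finite ?V" "?V \<noteq> {}"
    using finite_W u by auto
  obtain v where v: "v \<in> ?V" "\<And>v'. v' \<in> ?V \<Longrightarrow> v' ctr \<bullet> x \<le> v ctr \<bullet> x"
    using obtains_MAX[OF V, of "\<lambda>v. v ctr \<bullet> x"] Max_ge[of "(\<lambda>v. v ctr \<bullet> x) ` ?V"] V(1)
    by (metis (no_types, lifting) finite_imageI imageI)
  have "0 \<le> v (\<alpha> k) \<bullet> x" if k: "k \<in> {1..d}" for k
  proof (rule ccontr)
    assume neg: "\<not> 0 \<le> v (\<alpha> k) \<bullet> x"
    have "v (coroot (\<alpha> k)) = (2 / (\<alpha> k \<bullet> \<alpha> k)) *\<^sub>R v (\<alpha> k)"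
      using v by (simp add: coroot_def linear_scale W_linear)
    then have "x \<bullet> v (coroot (\<alpha> k)) \<le> 0"
      using neg by (simp add: inner_commute divide_nonpos_nonneg mult_nonneg_nonpos)
    then have "wall h v k * (x \<bullet> v (coroot (\<alpha> k))) \<le> 0"
      using v k by (intro mult_nonneg_nonpos assms(1)) auto
    moreover have "piece h v x - piece h (v \<circ> s k) x = wall h v k * (x \<bullet> v (coroot (\<alpha> k)))"
      using v k by (intro piece_adjacent) auto
    ultimately have "piece h v x \<le> piece h (v \<circ> s k) x"
      by linarith
    then have "v \<circ> s k \<in> ?V"
      using v W_comp[OF _ W_s[OF k], of v] by (simp del: comp_apply)
    \<comment> \<open>As \<open>ctr\<close> pairs to 1 with each simple coroot, the objective grows
      by exactly the amount by which \<open>x\<close> violates the wall.\<close>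
    moreover have "(v \<circ> s k) ctr = v ctr - v (\<alpha> k)"
      using v k ctr_coroot by (simp add: root_refl_coroot linear_diff W_linear)
    ultimately show False
      using v(2)[of "v \<circ> s k"] neg by (simp add: inner_diff_left)
  qed
  then show thesis
    using that v by blast
qed

lemma inner_W_coroot_inverse:
  assumes "u \<in> W" "\<And>x. u (u' x) = x"
  shows "x \<bullet> u y = u' x \<bullet> y"
  using W_inner[OF assms(1), of "u' x" y] assms(2) by simp

text \<open>Pulled back to \<open>D\<close> by \<open>u\<close> and by \<open>v\<close>,
  \<open>x\<close> becomes the same point. By \<open>W_stabilizer\<close>, \<open>u\<close> and
  \<open>v\<close> agree on each ray whose coordinate there is nonzero, so the sums agree term by
  term.\<close>

lemma piece_unique:
  assumes u: "u \<in> W" "\<And>k. k \<in> {1..d} \<Longrightarrow> 0 \<le> u (\<alpha> k) \<bullet> x"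
    and v: "v \<in> W" "\<And>k. k \<in> {1..d} \<Longrightarrow> 0 \<le> v (\<alpha> k) \<bullet> x"
  shows "piece h u x = piece h v x"
proof -
  obtain u' where u': "u' \<in> W" "\<And>x. u' (u x) = x" "\<And>x. u (u' x) = x"
    using W_inverse[OF u(1)] by metis
  obtain v' where v': "v' \<in> W" "\<And>x. v' (v x) = x" "\<And>x. v (v' x) = x"
    using W_inverse[OF v(1)] by metis
  let ?t = "v' \<circ> u"
  have t: "?t \<in> W"
    using u v' W_comp by auto
  have D: "u' x \<in> D" "v' x \<in> D"
    using u v inner_W_coroot_inverse[OF u(1) u'(3)] inner_W_coroot_inverse[OF v(1) v'(3)]
    by (simp_all add: D_eq inner_commute)
  have eq: "v' x = u' x"
    using W_fundamental_domain[OF t, of "u' x"] D u' by simp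
  show ?thesis
    unfolding piece_def
  proof (rule sum.cong)
    fix j assume j: "j \<in> {1..d}"
    have "u (lam j) = v (lam j)" if "u' x \<bullet> coroot (\<alpha> j) \<noteq> 0"
      using W_stabilizer[OF t D(1) _ j that] eq u' v'(3)[of "u (lam j)"] by simp
    moreover have "x \<bullet> u (coroot (\<alpha> j)) = u' x \<bullet> coroot (\<alpha> j)"
      "x \<bullet> v (coroot (\<alpha> j)) = u' x \<bullet> coroot (\<alpha> j)"
      using eq inner_W_coroot_inverse[OF u(1) u'(3)] inner_W_coroot_inverse[OF v(1) v'(3)]
      by simp_all
    ultimately show "(x \<bullet> u (coroot (\<alpha> j))) * h (u (lam j)) = (x \<bullet> v (coroot (\<alpha> j))) * h (v (lam j))"
      by (cases "u' x \<bullet> coroot (\<alpha> j) = 0") simp_all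
  qed simp
qed

section \<open>Chambers of the arrangement as images of \<open>D\<close>\<close>

lemma chamber_subset:
  assumes "C \<in> chambers \<Phi>"
  obtains u where "u \<in> W" "\<And>x k. x \<in> C \<Longrightarrow> k \<in> {1..d} \<Longrightarrow> 0 \<le> u (\<alpha> k) \<bullet> x"
proof -
  obtain K where K: "K \<in> components (UNIV - (\<Union>\<alpha>\<in>\<Phi>. {x. \<alpha> \<bullet> x = 0}))" "C = closure K"
    using assms by (auto simp: chambers_def)
  obtain x where x: "x \<in> K"
    using in_components_nonempty[OF K(1)] by auto
  \<comment> \<open>For the zero function all wall inequalities are trivial, so \<open>climb\<close>
    just locates an image of \<open>D\<close> that contains \<open>x\<close>.\<close>
  obtain u where u: "u \<in> W" "\<And>k. k \<in> {1..d} \<Longrightarrow> 0 \<le> u (\<alpha> k) \<bullet> x"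
    using climb[of "\<lambda>_. 0" id x] W_id by (auto simp: wall_def)
  have "0 \<le> u (\<alpha> k) \<bullet> y" if y: "y \<in> C" and k: "k \<in> {1..d}" for y k
  proof -
    have "u (\<alpha> k) \<bullet> z \<noteq> 0" if "z \<in> K" for z
      using in_components_subset[OF K(1)] that W_root[OF u(1) simple_root[OF k]] by auto
    then have "(\<forall>x\<in>K. 0 < u (\<alpha> k) \<bullet> x) \<or> (\<forall>x\<in>K. u (\<alpha> k) \<bullet> x < 0)"
      using inner_sign_on_connected in_components_connected[OF K(1)] by blast
    then have "0 \<le> u (\<alpha> k) \<bullet> z" if "z \<in> K" for z
      using u(2)[OF k] x that by force
    then show ?thesis
      using inner_nonneg_closure y K(2) by blast
  qed
  then show thesis
    using that u by blast
qed

lemma pos_inner_interior: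
  assumes "\<beta> \<in> \<Phi>" "pos \<beta>" "\<And>k. k \<in> {1..d} \<Longrightarrow> 0 < \<alpha> k \<bullet> x"
  shows "0 < \<beta> \<bullet> x"
proof -
  have c: "0 < coroot (\<alpha> j) \<bullet> x" if "j \<in> {1..d}" for j
    using assms(3)[OF that] simple_root_nonzero[OF that] by (simp add: coroot_def)
  obtain k where k: "k \<in> {1..d}" "\<beta> \<bullet> lam k \<noteq> 0"
    using eq_if_lam_inner_eq[of \<beta> 0] root_nonzero[OF assms(1)] by auto
  have "0 < (\<Sum>j\<in>{1..d}. (\<beta> \<bullet> lam j) * (coroot (\<alpha> j) \<bullet> x))"
  proof (rule sum_pos2[OF _ k(1)])
    show "0 < (\<beta> \<bullet> lam k) * (coroot (\<alpha> k) \<bullet> x)"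
      using c[OF k(1)] k assms(2) by (force simp: pos_def)
    show "0 \<le> (\<beta> \<bullet> lam j) * (coroot (\<alpha> j) \<bullet> x)" if "j \<in> {1..d}" for j
      using c[OF that] that assms(2) by (force simp: pos_def)
  qed simp
  then show ?thesis
    by (subst expand_coroot) (simp add: inner_sum_left)
qed

text \<open>The image of the interior \<open>E\<close> is connected and avoids all root hyperplanes,
  so it lies in one component \<open>K\<close>; the cone is the closure of \<open>K\<close>.\<close>

lemma W_D_subset_cone:
  assumes "w \<in> W"
  obtains C where "C \<in> coxeter_complex \<Phi>" "w ` D \<subseteq> C"
proof -
  let ?M = "UNIV - (\<Union>\<alpha>\<in>\<Phi>. {x. \<alpha> \<bullet> x = 0})"
  define E where "E = {x. \<forall>k\<in>{1..d}. 0 < \<alpha> k \<bullet> x}"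
  obtain w' where w': "w' \<in> W" "\<And>x. w' (w x) = x" "\<And>x. w (w' x) = x"
    using W_inverse[OF assms] by metis
  have "E = (\<Inter>k\<in>{1..d}. {x. \<alpha> k \<bullet> x > 0})"
    by (auto simp: E_def)
  then have "convex E"
    by (simp add: convex_INT convex_halfspace_gt)
  then have "connected (w ` E)"
    by (intro convex_connected convex_linear_image W_linear assms)
  moreover have "w ` E \<subseteq> ?M"
  proof clarsimp
    fix x \<beta> assume x: "x \<in> E" and \<beta>: "\<beta> \<in> \<Phi>" "\<beta> \<bullet> w x = 0"
    have "w' \<beta> \<in> \<Phi>" "w' \<beta> \<bullet> x = 0"
      using W_root w' \<beta> inner_W_coroot_inverse[OF assms w'(3)] by auto
    then show False
      using pos_or_neg[of "w' \<beta>"] pos_inner_interior[of "w' \<beta>" x] pos_inner_interior[of "- w' \<beta>" x]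
        uminus_root x by (force simp: E_def)
  qed
  moreover have ctr: "ctr \<in> E"
    using simple_root_ctr by (simp add: E_def)
  ultimately obtain K where K: "K \<in> components ?M" "w ` E \<subseteq> K"
    using exists_component_superset[of "w ` E" ?M] by blast
  have "closure K \<in> chambers \<Phi>"
    using K by (simp add: chambers_def)
  \<comment> \<open>Equality makes \<open>K\<close> convex, and a convex closure is a face of
    itself, as \<open>coxeter_complex\<close> demands.\<close>
  moreover have "K = w ` E"
  proof
    show "K \<subseteq> w ` E"
    proof
      fix z assume z: "z \<in> K"
      have "0 < \<alpha> k \<bullet> w' z" if k: "k \<in> {1..d}" for k
      proof -
        have "w (\<alpha> k) \<bullet> y \<noteq> 0" if "y \<in> K" for y
          using in_components_subset[OF K(1)] that W_root[OF assms simple_root[OF k]] by auto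
        then have "(\<forall>y\<in>K. 0 < w (\<alpha> k) \<bullet> y) \<or> (\<forall>y\<in>K. w (\<alpha> k) \<bullet> y < 0)"
          using inner_sign_on_connected in_components_connected[OF K(1)] by blast
        moreover have "w ctr \<in> K" "0 < w (\<alpha> k) \<bullet> w ctr"
          using K(2) ctr W_inner[OF assms] simple_root_ctr[OF k] by auto
        ultimately have "0 < w (\<alpha> k) \<bullet> z"
          using z by force
        then show ?thesis
          using inner_W_coroot_inverse[OF assms w'(3), of z "\<alpha> k"] by (simp add: inner_commute)
      qed
      then show "z \<in> w ` E"
        using w'(3)[of z] by (auto simp: E_def intro!: image_eqI[of _ _ "w' z"])
    qed
  qed (rule K(2))
  then have "convex K"
    using \<open>convex E\<close> W_linear[OF assms] by (simp add: convex_linear_image)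
  ultimately have "closure K \<in> coxeter_complex \<Phi>"
    using K ctr by (auto simp: coxeter_complex_def intro!: bexI[of _ "closure K"] face_of_refl convex_closure)
  moreover have "w x \<in> closure K" if x: "x \<in> D" for x
  proof (rule closure_approachable[THEN iffD2, rule_format])
    fix e :: real assume e: "0 < e"
    \<comment> \<open>A shift by \<open>t *\<^sub>R ctr\<close> moves \<open>x\<close> into
      \<open>E\<close> by less than \<open>e\<close>; the added 1 keeps the denominator
      positive.\<close>
    define t where "t = e / (norm ctr + 1)"
    have t: "0 < t" "t * norm ctr < e"
      using e by (simp_all add: t_def field_simps add_pos_nonneg)
    have "x + t *\<^sub>R ctr \<in> E"
      using x t simple_root_ctr by (auto simp: E_def D_eq inner_add_right intro!: add_nonneg_pos)
    then have "w (x + t *\<^sub>R ctr) \<in> K"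
      using K(2) by blast
    moreover have "dist (w (x + t *\<^sub>R ctr)) (w x) < e"
      using t W_orthogonal[OF assms]
      by (simp add: dist_norm linear_diff[OF W_linear[OF assms], symmetric] orthogonal_transformation_norm)
    ultimately show "\<exists>y\<in>K. dist y (w x) < e"
      by blast
  qed
  ultimately show thesis
    using that by blast
qed

subsection \<open>Local convexity across walls\<close>

text \<open>Under the wall inequalities this is the extension of \<open>h\<close>; as a maximum of
  linear functions it is convex.\<close>

definition envelope :: "('a \<Rightarrow> real) \<Rightarrow> 'a \<Rightarrow> real" where
  "envelope h x = (SUP u\<in>W. piece h u x)"

text \<open>From any \<open>v\<close>, \<open>climb\<close> leads to a chamber that contains
  \<open>x\<close> without lowering the value at \<open>x\<close>; there the value is that of
  \<open>u\<close>, by \<open>piece_unique\<close>.\<close>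

lemma envelope_eq_piece:
  assumes walls: "\<And>u k. u \<in> W \<Longrightarrow> k \<in> {1..d} \<Longrightarrow> 0 \<le> wall h u k"
    and u: "u \<in> W" "\<And>k. k \<in> {1..d} \<Longrightarrow> 0 \<le> u (\<alpha> k) \<bullet> x"
  shows "envelope h x = piece h u x"
  unfolding envelope_def
proof (rule cSup_eq_maximum)
  fix y assume "y \<in> (\<lambda>u. piece h u x) ` W"
  then obtain v where v: "v \<in> W" "y = piece h v x" by blast
  obtain v' where "v' \<in> W" "\<And>k. k \<in> {1..d} \<Longrightarrow> 0 \<le> v' (\<alpha> k) \<bullet> x" "piece h v x \<le> piece h v' x"
    using climb[OF walls v(1), where x = x] by blast
  then show "y \<le> piece h u x"
    using piece_unique[of v' x u h] u v by simp
qed (use u in blast)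

lemma envelope_ge_piece:
  assumes "\<And>u k. u \<in> W \<Longrightarrow> k \<in> {1..d} \<Longrightarrow> 0 \<le> wall h u k" and "u \<in> W"
  shows "piece h u x \<le> envelope h x"
  using climb[OF assms, where x = x] envelope_eq_piece[OF assms(1), where x = x] by metis

lemma envelope_attained:
  assumes "\<And>u k. u \<in> W \<Longrightarrow> k \<in> {1..d} \<Longrightarrow> 0 \<le> wall h u k"
  obtains u where "u \<in> W" "envelope h x = piece h u x"
  using climb[OF assms W_id, where x = x] envelope_eq_piece[OF assms, where x = x] by metis

lemma convex_on_envelope:
  assumes walls: "\<And>u k. u \<in> W \<Longrightarrow> k \<in> {1..d} \<Longrightarrow> 0 \<le> wall h u k"
  shows "convex_on UNIV (envelope h)"
proof (rule convex_onI)
  fix t :: real and x y :: 'a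
  assume t: "0 < t" "t < 1"
  obtain u where u: "u \<in> W" "envelope h ((1 - t) *\<^sub>R x + t *\<^sub>R y) = piece h u ((1 - t) *\<^sub>R x + t *\<^sub>R y)"
    using envelope_attained[OF walls] by metis
  have "piece h u ((1 - t) *\<^sub>R x + t *\<^sub>R y) = (1 - t) * piece h u x + t * piece h u y"
    by (simp add: linear_add linear_scale piece_linear)
  also have "\<dots> \<le> (1 - t) * envelope h x + t * envelope h y"
    using t envelope_ge_piece[OF walls u(1)] by (intro add_mono mult_left_mono) auto
  finally show "envelope h ((1 - t) *\<^sub>R x + t *\<^sub>R y) \<le> (1 - t) * envelope h x + t * envelope h y"
    using u by simp
qed simp

text \<open>If \<open>g\<close> is a convex extension, compare its values at
  \<open>u (lam k)\<close>, \<open>u (s k (lam k))\<close> and their midpoint, which lies in the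
  image of \<open>D\<close> under \<open>u\<close>, where \<open>g\<close> is linear. Conversely,
  \<open>envelope h\<close> is the extension.\<close>

lemma submodular_iff_wall:
  "submodular \<Phi> (weight_orbit \<Phi> d lam) h \<longleftrightarrow> (\<forall>u\<in>W. \<forall>k\<in>{1..d}. 0 \<le> wall h u k)"
proof (intro iffI ballI)
  fix u k assume u: "u \<in> W" and k: "k \<in> {1..d}" and "submodular \<Phi> (weight_orbit \<Phi> d lam) h"
  then obtain g where g: "linear_on_cones \<Phi> g" "\<And>r. r \<in> weight_orbit \<Phi> d lam \<Longrightarrow> g r = h r"
    "convex_on UNIV g"
    by (auto simp: submodular_def)
  obtain C where C: "C \<in> coxeter_complex \<Phi>" "u ` D \<subseteq> C"
    using W_D_subset_cone[OF u] by blast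
  obtain f where f_lin: "linear f" and f_C: "\<forall>x\<in>C. g x = f x"
    using g(1) C(1) by (auto simp: linear_on_cones_def)
  have f: "g (u x) = f (u x)" if "x \<in> D" for x
    using f_C C(2) that by blast
  have orbit: "g (v (lam j)) = h (v (lam j))" if "v \<in> W" "j \<in> {1..d}" for v j
    using g(2) that by (auto simp: weight_orbit_def)
  have orbit': "g (u (s k (lam k))) = h (u (s k (lam k)))"
    using orbit[of "u \<circ> s k" k] W_comp[OF u W_s[OF k]] k by simp
  define p where "p = lam k + s k (lam k)"
  have "(1 / 2) *\<^sub>R p \<in> D"
    using wall_relation_in_D[OF k] by (simp add: p_def D_eq)
  then have "g (u ((1 / 2) *\<^sub>R p)) = f (u ((1 / 2) *\<^sub>R p))"
    by (rule f)
  also have "\<dots> = (1 / 2) * f (u p)"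
    using f_lin W_linear[OF u] by (simp add: linear_scale)
  also have "f (u p) = (\<Sum>j\<in>{1..d} - {k}. (- cartan \<alpha> j k) * f (u (lam j)))"
    using f_lin W_linear[OF u] unfolding p_def wall_relation[OF k]
    by (simp add: linear_sum linear_scale linear_neg)
  also have "\<dots> = (\<Sum>j\<in>{1..d} - {k}. (- cartan \<alpha> j k) * h (u (lam j)))"
    using f[OF lam_in_D] orbit[OF u] by (intro sum.cong) auto
  also have "\<dots> = - (\<Sum>j\<in>{1..d} - {k}. cartan \<alpha> j k * h (u (lam j)))"
    by (simp add: sum_negf)
  finally have lower: "g (u ((1 / 2) *\<^sub>R p)) = - (\<Sum>j\<in>{1..d} - {k}. cartan \<alpha> j k * h (u (lam j))) / 2"
    by simp
  have "u ((1 / 2) *\<^sub>R p) = (1 - 1 / 2) *\<^sub>R u (lam k) + (1 / 2) *\<^sub>R u (s k (lam k))"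
    using W_linear[OF u] by (simp add: p_def linear_add linear_scale scaleR_add_right)
  then have "g (u ((1 / 2) *\<^sub>R p)) \<le> (1 - 1 / 2) * g (u (lam k)) + (1 / 2) * g (u (s k (lam k)))"
    using convex_onD[OF g(3), of "1 / 2" "u (lam k)" "u (s k (lam k))"] by simp
  then show "0 \<le> wall h u k"
    using lower orbit' orbit[OF u k] by (simp add: wall_def)
next
  assume "\<forall>u\<in>W. \<forall>k\<in>{1..d}. 0 \<le> wall h u k"
  then have walls: "0 \<le> wall h u k" if "u \<in> W" "k \<in> {1..d}" for u k
    using that by blast
  have "linear_on_cones \<Phi> (envelope h)"
    unfolding linear_on_cones_def
  proof
    fix F assume "F \<in> coxeter_complex \<Phi>"
    then obtain C where C: "C \<in> chambers \<Phi>" "F \<subseteq> C"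
      by (auto simp: coxeter_complex_def dest: face_of_imp_subset)
    obtain u where "u \<in> W" "\<And>x k. x \<in> C \<Longrightarrow> k \<in> {1..d} \<Longrightarrow> 0 \<le> u (\<alpha> k) \<bullet> x"
      using chamber_subset[OF C(1)] by blast
    then show "\<exists>f. linear f \<and> (\<forall>x\<in>F. envelope h x = f x)"
      using C(2) envelope_eq_piece[OF walls] piece_linear by (intro exI[of _ "piece h u"]) auto
  qed
  moreover have "envelope h r = h r" if "r \<in> weight_orbit \<Phi> d lam" for r
  proof -
    from that obtain u k where u: "u \<in> W" "k \<in> {1..d}" "r = u (lam k)"
      by (auto simp: weight_orbit_def)
    have "envelope h r = piece h u r"
      using u W_inner[OF u(1)] simple_root_lam by (intro envelope_eq_piece walls) auto
    also have "\<dots> = (\<Sum>j\<in>{1..d}. if j = k then h (u (lam j)) else 0)"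
      unfolding piece_def using u W_inner[OF u(1)] by (intro sum.cong) (auto simp: lam_coroot)
    finally show ?thesis
      using u by simp
  qed
  ultimately show "submodular \<Phi> (weight_orbit \<Phi> d lam) h"
    using convex_on_envelope[OF walls] convex_on_continuous[of UNIV "envelope h"]
    by (auto simp: submodular_def)
qed

subsection \<open>Irredundancy of the wall inequalities\<close>

lemma wall_diff: "wall (\<lambda>x. f x - a * g x) u k = wall f u k - a * wall g u k"
  by (simp add: wall_def algebra_simps sum_subtractf sum_distrib_left)

text \<open>An orbit meets \<open>D\<close> only once, and the fundamental weights are distinct
  points of \<open>D\<close>.\<close>

lemma W_orbit_weights_disjoint:
  assumes "u \<in> W" "v \<in> W" "j \<in> {1..d}" "k \<in> {1..d}" "u (lam j) = v (lam k)"
  shows "j = k"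
proof -
  obtain v' where v': "v' \<in> W" "\<And>x. v' (v x) = x"
    using W_inverse[OF assms(2)] by metis
  then have "(v' \<circ> u) (lam j) = lam k"
    using assms by simp
  then have "lam k = lam j"
    using W_fundamental_domain[OF W_comp[OF v'(1) assms(1)] lam_in_D[OF assms(3)]]
      lam_in_D[OF assms(4)] by simp
  then show ?thesis
    using lam_coroot[OF assms(3,4)] lam_coroot[OF assms(4,4)] by (metis zero_neq_one)
qed

text \<open>The support function of the permutahedron with vertex \<open>ctr\<close>.\<close>

definition perm :: "'a \<Rightarrow> real" where
  "perm x = (SUP u\<in>W. u x \<bullet> ctr)"

text \<open>By dominance no element of the orbit of \<open>lam k\<close> pairs higher with
  \<open>ctr\<close> than \<open>lam k\<close> does.\<close>

lemma perm_orbit: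
  assumes "u \<in> W" "k \<in> {1..d}"
  shows "perm (u (lam k)) = lam k \<bullet> ctr"
  unfolding perm_def
proof (rule cSup_eq_maximum)
  obtain u' where "u' \<in> W" "\<And>x. u' (u x) = x"
    using W_inverse[OF assms(1)] by metis
  then show "lam k \<bullet> ctr \<in> (\<lambda>v. v (u (lam k)) \<bullet> ctr) ` W"
    by (intro image_eqI[of _ _ u']) auto
  fix y assume "y \<in> (\<lambda>v. v (u (lam k)) \<bullet> ctr) ` W"
  then obtain v where v: "v \<in> W" "y = v (u (lam k)) \<bullet> ctr" by blast
  have "pos (lam k - (v \<circ> u) (lam k))"
    using v assms by (intro W_dominance W_comp lam_in_D)
  then have "0 \<le> (lam k - (v \<circ> u) (lam k)) \<bullet> ctr"
    unfolding ctr_def inner_sum_right by (intro sum_nonneg) (auto simp: pos_def)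
  then show "y \<le> lam k \<bullet> ctr"
    using v by (simp add: inner_diff_left)
qed

text \<open>As \<open>perm\<close> is constant on orbits, the functional reproduces the expansion of
  \<open>\<alpha> k\<close> in fundamental weights, paired with \<open>ctr\<close>.\<close>

lemma wall_perm:
  assumes "u \<in> W" "k \<in> {1..d}"
  shows "wall perm u k = \<alpha> k \<bullet> ctr"
proof -
  have "perm (u (s k (lam k))) = lam k \<bullet> ctr"
    using perm_orbit[of "u \<circ> s k" k] W_comp W_s assms by simp
  moreover have "\<alpha> k \<bullet> ctr = 2 * (lam k \<bullet> ctr) + (\<Sum>j\<in>{1..d} - {k}. cartan \<alpha> j k * (lam j \<bullet> ctr))"
    using assms by (subst simple_root_expand_lam)
      (simp add: inner_sum_left sum.remove[of _ k] cartan_diag inner_add_left)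
  ultimately show ?thesis
    using assms by (simp add: wall_def perm_orbit)
qed

text \<open>In either order, the pair determines the image of
  \<open>p = lam i + s i (lam i)\<close>, so \<open>w' \<circ> u\<close> fixes \<open>p\<close>. By
  \<open>W_stabilizer\<close> it fixes each \<open>lam j\<close> with a nonzero coefficient in the
  functional.\<close>

lemma wall_eqI:
  assumes u: "u \<in> W" and w: "w \<in> W" and i: "i \<in> {1..d}"
    and pair: "{u (lam i), u (s i (lam i))} = {w (lam i), w (s i (lam i))}"
  shows "wall h u i = wall h w i"
proof -
  have neq: "s i (lam i) \<noteq> lam i"
    using i simple_root_nonzero by (simp add: s_lam)
  obtain w' where w': "w' \<in> W" "\<And>x. w' (w x) = x" "\<And>x. w (w' x) = x"
    using W_inverse[OF w] by metis
  obtain u' where u': "\<And>x. u' (u x) = x"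
    using W_inverse[OF u] by metis
  have "u (lam i) \<noteq> u (s i (lam i))" "w (lam i) \<noteq> w (s i (lam i))"
    using neq w' u' by metis+
  then have cases: "u (lam i) = w (lam i) \<and> u (s i (lam i)) = w (s i (lam i)) \<or>
      u (lam i) = w (s i (lam i)) \<and> u (s i (lam i)) = w (lam i)"
    using pair by (auto simp: doubleton_eq_iff)
  define p where "p = lam i + s i (lam i)"
  have "u p = w p"
    using cases W_linear[OF u] W_linear[OF w] by (auto simp: p_def linear_add)
  then have fix_p: "(w' \<circ> u) p = p"
    using w' by simp
  have "cartan \<alpha> j i * h (u (lam j)) = cartan \<alpha> j i * h (w (lam j))" if j: "j \<in> {1..d} - {i}" for j
  proof (cases "cartan \<alpha> j i = 0")
    case False
    have "p \<bullet> coroot (\<alpha> j) = - cartan \<alpha> j i"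
      using i j by (simp add: p_def inner_add_left root_refl_inner s_coroot inner_diff_right lam_coroot)
    then have "(w' \<circ> u) (lam j) = lam j"
      using False fix_p j W_comp[OF w'(1) u] wall_relation_in_D[OF i]
      by (intro W_stabilizer[of _ p]) (simp_all add: p_def del: comp_apply)
    then show ?thesis
      using w'(3)[of "u (lam j)"] by simp
  qed simp
  then have "(\<Sum>j\<in>{1..d} - {i}. cartan \<alpha> j i * h (u (lam j)))
      = (\<Sum>j\<in>{1..d} - {i}. cartan \<alpha> j i * h (w (lam j)))"
    by (rule sum.cong[OF refl])
  then show ?thesis
    using cases by (auto simp: wall_def)
qed

text \<open>Distinct pairs \<open>(u, k)\<close> may define the same functional, for instance
  \<open>(w, i)\<close> and \<open>(w \<circ> s i, i)\<close>; hence the disjunction.\<close>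

lemma wall_irredundant:
  assumes w: "w \<in> W" and i: "i \<in> {1..d}"
  obtains f where "wall f w i = 0"
    "\<And>u k. u \<in> W \<Longrightarrow> k \<in> {1..d} \<Longrightarrow> 0 < wall f u k \<or> (\<forall>h. wall h u k = wall h w i)"
proof -
  define T where "T = {w (lam i), w (s i (lam i))}"
  define \<delta> :: "'a \<Rightarrow> real" where "\<delta> = indicator T"
  define c where "c = \<alpha> i \<bullet> ctr"
  have c: "0 < c"
    using simple_root_ctr[OF i] by (simp add: c_def)
  have T_orbit: "\<exists>v\<in>W. x = v (lam i)" if "x \<in> T" for x
    using that w W_comp[OF w W_s[OF i]] unfolding T_def
    by (metis comp_apply insertE singletonD)
  have \<delta>_other: "\<delta> (u (lam j)) = 0" if "u \<in> W" "j \<in> {1..d}" "j \<noteq> i" for u j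
    using T_orbit W_orbit_weights_disjoint[of u _ j i] that i by (auto simp: \<delta>_def indicator_def)
  have \<delta>_i: "wall \<delta> u i = \<delta> (u (lam i)) + \<delta> (u (s i (lam i)))" if "u \<in> W" for u
  proof -
    have "(\<Sum>j\<in>{1..d} - {i}. cartan \<alpha> j i * \<delta> (u (lam j))) = 0"
      using \<delta>_other[OF that] by (intro sum.neutral) auto
    then show ?thesis
      by (simp add: wall_def)
  qed
  show thesis
  proof (rule that[of "\<lambda>x. perm x - c / 2 * \<delta> x"])
    show "wall (\<lambda>x. perm x - c / 2 * \<delta> x) w i = 0"
      using w i by (simp only: wall_diff wall_perm \<delta>_i) (simp add: \<delta>_def T_def c_def)
    fix u k assume u: "u \<in> W" and k: "k \<in> {1..d}"
    have eq: "wall (\<lambda>x. perm x - c / 2 * \<delta> x) u k = \<alpha> k \<bullet> ctr - c / 2 * wall \<delta> u k"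
      using u k by (simp only: wall_diff wall_perm)
    show "0 < wall (\<lambda>x. perm x - c / 2 * \<delta> x) u k \<or> (\<forall>h. wall h u k = wall h w i)"
    proof (cases "k = i")
      case False
      \<comment> \<open>The two positive terms lie in an orbit disjoint from \<open>T\<close>, and
        the remaining coefficients are nonpositive, so the lowering cannot decrease this
        functional.\<close>
      have "(\<Sum>j\<in>{1..d} - {k}. cartan \<alpha> j k * \<delta> (u (lam j))) \<le> 0"
        using cartan_nonpos k by (intro sum_nonpos mult_nonpos_nonneg) (auto simp: \<delta>_def)
      then have "wall \<delta> u k \<le> 0"
        using \<delta>_other[of u k] \<delta>_other[of "u \<circ> s k" k] u k False W_comp[OF u W_s[OF k]]
        by (simp add: wall_def)
      then have "c / 2 * wall \<delta> u k \<le> 0"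
        using c by (simp add: mult_nonneg_nonpos)
      then show ?thesis
        using simple_root_ctr[OF k] eq by simp
    next
      case True
      show ?thesis
      proof (cases "u (lam i) \<in> T \<and> u (s i (lam i)) \<in> T")
        case both: True
        obtain u' where u': "\<And>x. u' (u x) = x"
          using W_inverse[OF u] by metis
        have "s i (lam i) \<noteq> lam i"
          using i simple_root_nonzero by (simp add: s_lam)
        then have "u (lam i) \<noteq> u (s i (lam i))"
          using u' by metis
        then have "{u (lam i), u (s i (lam i))} = T"
          using both by (auto simp: T_def)
        then show ?thesis
          using wall_eqI[OF u w i] True by (auto simp: T_def)
      next
        case False
        \<comment> \<open>At most one of the two positive terms is lowered, so at least
          \<open>c / 2\<close> remains.\<close>
        then have "wall \<delta> u i \<le> 1"
          using \<delta>_i[OF u] by (auto simp: \<delta>_def indicator_def)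
        then have "c / 2 * wall \<delta> u i \<le> c / 2"
          using c by (simp add: mult_left_le)
        then show ?thesis
          using eq c True by (simp add: c_def)
      qed
    qed
  qed
qed

end

section \<open>Transfer to coordinates and conclusion\<close>

theorem theorem7p1:
  fixes \<Phi> D R :: "'a::euclidean_space set"
    and d :: nat
    and \<alpha> lam :: "nat \<Rightarrow> 'a"
    and \<rho> :: "'r::finite \<Rightarrow> 'a"
    and w :: "'a \<Rightarrow> 'a"
    and i :: nat
  assumes "root_system \<Phi>"
    and "d = dim \<Phi>"
    and "D \<in> chambers \<Phi>"
    and "simple_roots \<Phi> D d \<alpha>"
    and "fundamental_weights d \<alpha> lam"
    and "R = weight_orbit \<Phi> d lam"
    and "bij_betw \<rho> UNIV R"
    and "w \<in> weyl_group \<Phi>"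
    and "i \<in> {1..d}"
  shows "(\<forall>h\<in>SF \<Phi> R \<rho>.
            val \<rho> h (w (lam i)) + val \<rho> h (w (root_refl (\<alpha> i) (lam i)))
              \<ge> (\<Sum>j\<in>neighbors d \<alpha> i. - cartan \<alpha> j i * val \<rho> h (w (lam j)))) \<and>
         (SF \<Phi> R \<rho> \<inter>
            {h. val \<rho> h (w (lam i)) + val \<rho> h (w (root_refl (\<alpha> i) (lam i)))
                  = (\<Sum>j\<in>neighbors d \<alpha> i. - cartan \<alpha> j i * val \<rho> h (w (lam j)))})
           facet_of SF \<Phi> R \<rho>"
proof -
  interpret based_root_system \<Phi> D d \<alpha> lam
    by unfold_locales (fact assms)+
  note w = assms(8) and i = assms(9)
  define e :: "'a \<Rightarrow> real ^ 'r" where "e x = axis (inv_into UNIV \<rho> x) 1" for x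
  \<comment> \<open>The normal vector of the wall functional, built from the coordinate vectors
    \<open>e\<close>.\<close>
  define n where "n u k = e (u (lam k)) + e (u (s k (lam k)))
      + (\<Sum>j\<in>{1..d} - {k}. cartan \<alpha> j k *\<^sub>R e (u (lam j)))" for u k
  have n: "n u k \<bullet> h = wall (val \<rho> h) u k" for u k h
    by (simp add: n_def e_def wall_def val_def inner_add_left inner_sum_left inner_axis')
  define A where "A = (\<lambda>(u, k). n u k) ` (W \<times> {1..d})"
  have SF: "SF \<Phi> R \<rho> = {h. \<forall>b\<in>A. 0 \<le> b \<bullet> h}"
    by (auto simp: SF_def assms(6) submodular_iff_wall A_def n)
  have ineq: "val \<rho> h (w (lam i)) + val \<rho> h (w (s i (lam i)))
      = (\<Sum>j\<in>neighbors d \<alpha> i. - cartan \<alpha> j i * val \<rho> h (w (lam j))) + n w i \<bullet> h" for h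
    by (simp add: n wall_neighbors)
  have nA: "n w i \<in> A"
    using w i by (auto simp: A_def)
  have valR: "val \<rho> (\<chi> r. f (\<rho> r)) (u (lam j)) = f (u (lam j))" if "u \<in> W" "j \<in> {1..d}" for f u j
  proof -
    have "u (lam j) \<in> R"
      using that assms(6) by (auto simp: weight_orbit_def)
    then show ?thesis
      using bij_betw_inv_into_right[OF assms(7)] by (simp add: val_def)
  qed
  have n_vec: "n u k \<bullet> (\<chi> r. f (\<rho> r)) = wall f u k" if "u \<in> W" "k \<in> {1..d}" for f u k
    using that valR[of u] valR[of "u \<circ> s k" k] W_comp[OF that(1) W_s[OF that(2)]]
    by (simp add: n wall_def)
  obtain f where f: "wall f w i = 0"
    "\<And>u k. u \<in> W \<Longrightarrow> k \<in> {1..d} \<Longrightarrow> 0 < wall f u k \<or> (\<forall>h. wall h u k = wall h w i)"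
    using wall_irredundant[OF w i] by blast
  \<comment> \<open>The positive value at the permutahedron shows that the normal vector is
    nonzero.\<close>
  have "n w i \<bullet> (\<chi> r. perm (\<rho> r)) > 0"
    using simple_root_ctr i w by (simp add: n_vec wall_perm)
  then have "n w i \<noteq> 0"
    by auto
  have "(SF \<Phi> R \<rho> \<inter> {h. n w i \<bullet> h = 0}) facet_of SF \<Phi> R \<rho>"
    unfolding SF
  proof (rule facet_of_Int_halfspaces[OF _ nA \<open>n w i \<noteq> 0\<close>])
    show "finite A"
      by (simp add: A_def finite_W)
    show "n w i \<bullet> (\<chi> r. f (\<rho> r)) = 0"
      using f(1) w i by (simp add: n_vec)
    fix b assume b: "b \<in> A" "b \<noteq> n w i"
    then obtain u k where u: "u \<in> W" "k \<in> {1..d}" "b = n u k"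
      by (auto simp: A_def)
    have "0 < wall f u k"
    proof (rule ccontr)
      assume "\<not> 0 < wall f u k"
      \<comment> \<open>Equal functionals have equal normal vectors, which contradicts the choice of
        \<open>b\<close>.\<close>
      then have "\<forall>h. n u k \<bullet> h = n w i \<bullet> h"
        using f(2)[OF u(1,2)] by (simp add: n)
      then show False
        using b u vector_eq_rdot by blast
    qed
    then show "0 < b \<bullet> (\<chi> r. f (\<rho> r))"
      using u by (simp add: n_vec)
  qed
  then show ?thesis
    using nA by (auto simp: SF ineq)
qed

end
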